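(* Let $\underline{X}=(X_1,\dots,X_n)$ where the $X_i$ are iid, let $f$ be a probability density on $(0,1)$, and for $\underline{x}=(x_1,\dots,x_n)\in(0,1)^n$ put $$p_1(\underline{x})=f(x_1)\cdots f(x_n),\qquad p_2(\underline{x})=f(1-x_1)\cdots f(1-x_n).$$ For testing the hypothesis $H$ that the $X_i$ are uniformly distributed on $(0,1)$ against the two alternatives that $\underline{X}$ has density $p_1$ or density $p_2$, there exists among all level $\alpha$ symmetric rejection regions $R$ one that maximizes the power against both $p_1$ and $p_2$, and it rejects $H$ when $$\tfrac12[p_1(\underline{x})+p_2(\underline{x})]\quad\text{is sufficiently large.}$$
   Context: A rejection region is a set $R\subseteq(0,1)^n$; the corresponding test rejects $H$ when $\underline{X}\in R$. Its level refers to its rejection probability under $H$, and its power against $p_j$ is $\int_R p_j(\underline{x})\,d\underline{x}$. A rejection region $R$ is called symmetric (invariant) if $(x_1,\dots,x_n)\in R$ if and only if $(1-x_1,\dots,1-x_n)\in R$. *)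

theory Defs
  imports "HOL-Probability.Probability"
begin

text \<open>
  Points of \<open>\<real>\<^sup>n\<close> are extensional functions on \<open>{..<n}\<close>, the carrier of
  the library's finite product measures; Lebesgue measure on \<open>\<real>\<^sup>n\<close> is
  \<open>\<Pi>\<^sub>M i\<in>{..<n}. lborel\<close>.
\<close>

definition unit_cube :: "nat \<Rightarrow> (nat \<Rightarrow> real) set" where
  "unit_cube n = (\<Pi>\<^sub>E i\<in>{..<n}. {0<..<1})"

text \<open>The values of \<open>f\<close> outside the open unit interval are unconstrained and never used.\<close>

definition density_on_unit_interval :: "(real \<Rightarrow> real) \<Rightarrow> bool" where
  "density_on_unit_interval f \<longleftrightarrow>
     f \<in> borel_measurable (restrict_space borel {0<..<1}) \<and>
     (\<forall>x\<in>{0<..<1}. 0 \<le> f x) \<and>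
     (\<integral>\<^sup>+x\<in>{0<..<1}. ennreal (f x) \<partial>lborel) = 1"

definition p1 :: "(real \<Rightarrow> real) \<Rightarrow> nat \<Rightarrow> (nat \<Rightarrow> real) \<Rightarrow> real" where
  "p1 f n x = (\<Prod>i<n. f (x i))"

definition p2 :: "(real \<Rightarrow> real) \<Rightarrow> nat \<Rightarrow> (nat \<Rightarrow> real) \<Rightarrow> real" where
  "p2 f n x = (\<Prod>i<n. f (1 - x i))"

definition rejection_region :: "nat \<Rightarrow> (nat \<Rightarrow> real) set \<Rightarrow> bool" where
  "rejection_region n R \<longleftrightarrow> R \<subseteq> unit_cube n \<and> R \<in> sets (\<Pi>\<^sub>M i\<in>{..<n}. (borel :: real measure))"

definition reflect :: "nat \<Rightarrow> (nat \<Rightarrow> real) \<Rightarrow> nat \<Rightarrow> real" where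
  "reflect n x = (\<lambda>i\<in>{..<n}. 1 - x i)"

definition symmetric_region :: "nat \<Rightarrow> (nat \<Rightarrow> real) set \<Rightarrow> bool" where
  "symmetric_region n R \<longleftrightarrow> (\<forall>x\<in>unit_cube n. x \<in> R \<longleftrightarrow> reflect n x \<in> R)"

text \<open>The joint law of the sample under the hypothesis: iid uniform coordinates.\<close>

definition null_law :: "nat \<Rightarrow> (nat \<Rightarrow> real) measure" where
  "null_law n = (\<Pi>\<^sub>M i\<in>{..<n}. uniform_measure lborel {0<..<1})"

text \<open>The level is the exact rejection probability under the hypothesis, not an upper bound for it.\<close>

definition test_level :: "nat \<Rightarrow> (nat \<Rightarrow> real) set \<Rightarrow> real" where
  "test_level n R = measure (null_law n) R"

definition test_power :: "nat \<Rightarrow> ((nat \<Rightarrow> real) \<Rightarrow> real) \<Rightarrow> (nat \<Rightarrow> real) set \<Rightarrow> real" where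
  "test_power n p R = (LINT x:R|(\<Pi>\<^sub>M i\<in>{..<n}. lborel). p x)"

definition level_symmetric_regions :: "nat \<Rightarrow> real \<Rightarrow> (nat \<Rightarrow> real) set set" where
  "level_symmetric_regions n \<alpha> =
     {R. rejection_region n R \<and> symmetric_region n R \<and> test_level n R = \<alpha>}"

text \<open>
  The region rejects when the statistic \<open>t\<close> is sufficiently large: above some cutoff it always
  rejects, below the cutoff it never does.  On the boundary \<open>t x = c\<close> either decision is allowed;
  for instance \<open>t\<close> is constant when \<open>f\<close> is the uniform density, and then neither \<open>{x. t x > c}\<close>
  nor \<open>{x. t x \<ge> c}\<close> has level strictly between 0 and 1.
\<close>

definition rejects_for_large_values :: "nat \<Rightarrow> ((nat \<Rightarrow> real) \<Rightarrow> real) \<Rightarrow> (nat \<Rightarrow> real) set \<Rightarrow> bool" where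
  "rejects_for_large_values n t R \<longleftrightarrow>
     (\<exists>c::real. \<forall>x\<in>unit_cube n. (t x > c \<longrightarrow> x \<in> R) \<and> (t x < c \<longrightarrow> x \<notin> R))"

end

theory Submission
  imports Defs
begin

text \<open>
  The reflection \<open>x \<mapsto> 1 - x\<close> preserves Lebesgue measure and exchanges \<open>p\<^sub>1\<close> and \<open>p\<^sub>2\<close>, so a
  symmetric region has the same power against both, namely its power against the mixture
  \<open>(p\<^sub>1 + p\<^sub>2) / 2\<close>. The Neyman-Pearson argument for the mixture therefore settles both alternatives,
  provided the most powerful region can be chosen symmetric and of exact level \<open>\<alpha>\<close>. The mixture is
  reflection-invariant; on its level set at the critical value the randomization of the classical
  test is replaced by splitting along the reflection-invariant statistic \<open>\<bar>x\<^sub>0 - 1/2\<bar>\<close>, which has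
  a continuous distribution under the hypothesis.
\<close>

section \<open>Upper regions of prescribed probability\<close>

text \<open>Intermediate value theorem for the distribution function of \<open>Y\<close> under
  \<open>M\<close> restricted to \<open>E\<close>: since \<open>Y\<close> has no atoms it is
  continuous, and it climbs from 0 to the measure of \<open>E\<close>.\<close>

lemma (in finite_measure) ex_vimage_measure_eq:
  fixes Y :: "'a \<Rightarrow> real"
  assumes Y [measurable]: "Y \<in> borel_measurable M" and E [measurable]: "E \<in> sets M"
    and atomless: "\<And>y. measure M {x \<in> space M. Y x = y} = 0"
    and a: "0 \<le> a" "a \<le> measure M E"
  shows "\<exists>B\<in>sets borel. measure M (E \<inter> Y -` B) = a"
proof -
  define D where "D = distr (restrict_space M E) borel Y"
  have Y' [measurable]: "Y \<in> borel_measurable (restrict_space M E)"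
    by (rule measurable_restrict_space1) simp
  have E_sub: "E \<subseteq> space M"
    using E by (rule sets.sets_into_space)
  interpret R: finite_measure "restrict_space M E"
    by (rule finite_measure_restrict_space) (auto intro: finite_measure_axioms)
  interpret D: finite_borel_measure D
    unfolding D_def finite_borel_measure_def finite_borel_measure_axioms_def
    by (simp add: R.finite_measure_distr)
  have D_eq: "measure D B = measure M (E \<inter> Y -` B)" if [measurable]: "B \<in> sets borel" for B
    using E_sub that unfolding D_def
    by (subst measure_distr) (auto simp: space_restrict_space measure_restrict_space Int_absorb2 Int_commute)
  have "isCont (cdf D) y" for y
  proof -
    have "measure M (E \<inter> Y -` {y}) \<le> measure M {x \<in> space M. Y x = y}"
      using E_sub by (intro finite_measure_mono) auto
    then show ?thesis
      unfolding D.isCont_cdf using atomless[of y] measure_nonneg[of M "E \<inter> Y -` {y}"]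
      by (simp add: D_eq)
  qed
  then have cont: "continuous_on S (cdf D)" for S
    by (simp add: continuous_at_imp_continuous_on)
  have total: "measure D (space D) = measure M E"
    using D_eq[of UNIV] by (simp add: D.borel_UNIV)
  \<comment> \<open>The distribution function may attain its two limit values at no real point, so
    these get \<open>{}\<close> and \<open>UNIV\<close>. Strictly between them the limits at minus
    and plus infinity supply the end points for \<open>IVT'\<close>, and \<open>B\<close> is a
    half-line.\<close>
  consider "a = 0" | "a = measure M E" | "0 < a" "a < measure M E"
    using a by linarith
  then show ?thesis
  proof cases
    case 1
    then show ?thesis
      by (intro bexI[of _ "{}"]) auto
  next
    case 2
    then show ?thesis
      by (intro bexI[of _ UNIV]) auto
  next
    case 3
    obtain y where y: "cdf D y < a"
      using order_tendstoD(2)[OF D.cdf_lim_at_bot 3(1)]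
      by (meson eventually_happens' trivial_limit_at_bot_linorder)
    obtain z where z: "a < cdf D z"
      using order_tendstoD(1)[OF D.cdf_lim_at_top, of a] 3(2) total
      by (metis eventually_happens' trivial_limit_at_top_linorder)
    have "y \<le> z"
      using D.cdf_nondecreasing[of z y] y z by linarith
    then obtain s where "cdf D s = a"
      using IVT'[of "cdf D" y a z] y z cont by auto
    then show ?thesis
      by (intro bexI[of _ "{..s}"]) (auto simp: cdf_def D_eq)
  qed
qed

text \<open>The witness is the generalized inverse of the distribution function at \<open>p\<close>,
  the least point where that function reaches \<open>p\<close>.\<close>

lemma (in prob_space) ex_quantile:
  fixes X :: "'a \<Rightarrow> real"
  assumes X [measurable]: "random_variable borel X" and p: "0 < p" "p < 1"
  shows "\<exists>c. prob {x \<in> space M. X x < c} \<le> p \<and> p \<le> prob {x \<in> space M. X x \<le> c}"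
proof -
  interpret D: cdf_distribution "distr M borel X"
    unfolding cdf_distribution_def by simp
  define c where "c = D.I p"
  have D_eq: "measure (distr M borel X) B = prob {x \<in> space M. X x \<in> B}" if "B \<in> sets borel" for B
    using that by (subst measure_distr) (auto intro!: arg_cong[where f = prob])
  have "p \<le> D.C c"
    using D.pseudoinverse[OF p, of c] by (simp add: c_def)
  \<comment> \<open>The mass of \<open>{..<c}\<close> is the left limit of the distribution function
    at \<open>c\<close>, and to the left of \<open>c\<close> that function stays below
    \<open>p\<close>.\<close>
  moreover have "measure (distr M borel X) {..<c} \<le> p"
  proof (rule tendsto_upperbound[OF D.cdf_at_left])
    show "\<forall>\<^sub>F x in at_left c. D.C x \<le> p"
      using eventually_at_left_real[of "c - 1" c, simplified]
    proof eventually_elim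
      case (elim x)
      then have "\<not> p \<le> D.C x"
        using D.pseudoinverse[OF p, of x] by (simp add: c_def)
      then show ?case by simp
    qed
  qed simp
  ultimately show ?thesis
    by (intro exI[of _ c]) (simp add: cdf_def D_eq)
qed

text \<open>With \<open>c\<close> a quantile of \<open>X\<close> at 1 - \<alpha>, the event
  \<open>X x > c\<close> has probability at most \<alpha> and \<open>X x \<ge> c\<close> at least
  \<alpha>. The missing mass is cut out of the level set \<open>X x = c\<close> by means of
  \<open>Y\<close>, so the region depends on \<open>X\<close> and \<open>Y\<close> alone and
  inherits their symmetries.\<close>

lemma (in prob_space) ex_upper_region:
  fixes X Y :: "'a \<Rightarrow> real"
  assumes [measurable]: "random_variable borel X" "random_variable borel Y"
    and atomless: "\<And>y. prob {x \<in> space M. Y x = y} = 0"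
    and \<alpha>: "0 < \<alpha>" "\<alpha> < 1"
  shows "\<exists>c. \<exists>B\<in>sets borel. prob {x \<in> space M. X x > c \<or> X x = c \<and> Y x \<in> B} = \<alpha>"
proof -
  obtain c where c: "prob {x \<in> space M. X x < c} \<le> 1 - \<alpha>" "1 - \<alpha> \<le> prob {x \<in> space M. X x \<le> c}"
    using ex_quantile[of X "1 - \<alpha>"] \<alpha> by auto
  let ?E = "{x \<in> space M. X x = c}" and ?G = "{x \<in> space M. X x > c}"
  have le: "prob {x \<in> space M. X x \<le> c} = 1 - prob ?G"
    by (subst prob_compl[symmetric]) (auto intro!: arg_cong[where f = prob])
  have "prob {x \<in> space M. X x \<le> c} = prob ({x \<in> space M. X x < c} \<union> ?E)"
    by (rule arg_cong[where f = prob]) auto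
  also have "\<dots> = prob {x \<in> space M. X x < c} + prob ?E"
    by (rule finite_measure_Union) auto
  finally have "0 \<le> \<alpha> - prob ?G" "\<alpha> - prob ?G \<le> prob ?E"
    using c le by linarith+
  then obtain B where B [measurable]: "B \<in> sets borel" and eq: "prob (?E \<inter> Y -` B) = \<alpha> - prob ?G"
    using ex_vimage_measure_eq[of Y ?E "\<alpha> - prob ?G"] atomless by auto
  have [measurable]: "{x \<in> space M. X x = c \<and> Y x \<in> B} \<in> sets M"
    by measurable
  have "?E \<inter> Y -` B = {x \<in> space M. X x = c \<and> Y x \<in> B}"
    by auto
  then have eq': "prob {x \<in> space M. X x = c \<and> Y x \<in> B} = \<alpha> - prob ?G"
    using eq by simp
  have "prob {x \<in> space M. X x > c \<or> X x = c \<and> Y x \<in> B}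
      = prob (?G \<union> {x \<in> space M. X x = c \<and> Y x \<in> B})"
    by (rule arg_cong[where f = prob]) auto
  also have "\<dots> = prob ?G + prob {x \<in> space M. X x = c \<and> Y x \<in> B}"
    by (rule finite_measure_Union) auto
  finally show ?thesis
    using eq' B by (intro exI[of _ c] bexI[of _ B]) simp_all
qed

section \<open>The Neyman-Pearson inequality\<close>

text \<open>Integrating \<open>t - c\<close> instead of \<open>t\<close> changes both sides by the
  same amount, because the measures agree. After that the integrands compare pointwise: the regions
  differ only where the sign of \<open>t - c\<close> favours \<open>R\<close>. Points with
  \<open>t x = c\<close> contribute nothing and may lie on either side.\<close>

lemma neyman_pearson:
  fixes t :: "'a \<Rightarrow> real"
  assumes [measurable]: "R \<in> sets M" "S \<in> sets M"
    and int: "set_integrable M R t" "set_integrable M S t"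
    and fin: "emeasure M R < \<infinity>" "emeasure M S < \<infinity>"
    and eq: "measure M S = measure M R"
    and large: "\<And>x. x \<in> R - S \<Longrightarrow> c \<le> t x" and small: "\<And>x. x \<in> S - R \<Longrightarrow> t x \<le> c"
  shows "(LINT x:S|M. t x) \<le> (LINT x:R|M. t x)"
proof -
  have const: "set_integrable M R (\<lambda>_. c)" "set_integrable M S (\<lambda>_. c)"
    using fin by (simp_all add: set_integrable_def integrable_mult_left)
  have "(LINT x:S|M. t x - c) \<le> (LINT x:R|M. t x - c)"
    unfolding set_lebesgue_integral_def
  proof (rule integral_mono)
    show "integrable M (\<lambda>x. indicator S x *\<^sub>R (t x - c))" "integrable M (\<lambda>x. indicator R x *\<^sub>R (t x - c))"
      using set_integral_diff(1)[OF int(2) const(2)] set_integral_diff(1)[OF int(1) const(1)]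
      by (simp_all add: set_integrable_def)
  next
    fix x
    show "indicator S x *\<^sub>R (t x - c) \<le> indicator R x *\<^sub>R (t x - c)"
      using large[of x] small[of x] by (auto simp: indicator_def)
  qed
  moreover have "(LINT x:A|M. t x - c) = (LINT x:A|M. t x) - measure M A * c"
    if "set_integrable M A t" "set_integrable M A (\<lambda>_. c)" "A \<in> sets M" for A
    using set_integral_diff(2)[OF that(1,2)] that(3)
    by (simp add: set_lebesgue_integral_def)
  ultimately show ?thesis
    using int const eq by simp
qed

section \<open>The null law and the reflection of the cube\<close>

lemma lborel_distr_reflect: "distr lborel borel (\<lambda>x. a - x :: real) = lborel"
  using lborel_real_affine[of "-1" a] by (simp add: density_1)

interpretation lborel_PiM: product_sigma_finite "\<lambda>_::nat. lborel :: real measure"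
  by standard

abbreviation lborel_n :: "nat \<Rightarrow> (nat \<Rightarrow> real) measure" where
  "lborel_n n \<equiv> (\<Pi>\<^sub>M i\<in>{..<n}. lborel)"

lemma sets_unit_cube [measurable]: "unit_cube n \<in> sets (lborel_n n)"
  unfolding unit_cube_def by (intro sets_PiM_I_finite) auto

lemma emeasure_unit_cube: "emeasure (lborel_n n) (unit_cube n) = 1"
  unfolding unit_cube_def by (subst lborel_PiM.emeasure_PiM) auto

text \<open>Both measures agree on boxes, which determines a finite product measure; the normalizing
  constant is 1 because the interval has length 1. Levels thereby become Lebesgue volumes, taken
  with respect to the measure that also defines the power.\<close>

lemma null_law_eq: "null_law n = density (lborel_n n) (indicator (unit_cube n))"
proof -
  interpret U: prob_space "uniform_measure lborel {0<..<1::real}"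
    by (rule prob_space_uniform_measure) simp_all
  interpret P: product_sigma_finite "\<lambda>_::nat. uniform_measure lborel {0<..<1::real}"
    by standard
  have "density (lborel_n n) (indicator (unit_cube n))
      = (\<Pi>\<^sub>M i\<in>{..<n}. uniform_measure lborel {0<..<1::real})"
  proof (rule P.PiM_eqI)
    show "sets (density (lborel_n n) (indicator (unit_cube n)))
        = sets (\<Pi>\<^sub>M i\<in>{..<n}. uniform_measure lborel {0<..<1::real})"
      by (simp cong: sets_PiM_cong)
  next
    fix A :: "nat \<Rightarrow> real set"
    assume "\<And>i. i \<in> {..<n} \<Longrightarrow> A i \<in> sets (uniform_measure lborel {0<..<1})"
    then have A: "A i \<in> sets borel" if "i < n" for i
      using that by simp
    have [measurable]: "Pi\<^sub>E {..<n} A \<in> sets (lborel_n n)"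
      using A by (intro sets_PiM_I_finite) auto
    have "emeasure (density (lborel_n n) (indicator (unit_cube n))) (Pi\<^sub>E {..<n} A)
        = emeasure (lborel_n n) (unit_cube n \<inter> Pi\<^sub>E {..<n} A)"
      by (rule emeasure_restricted) simp_all
    also have "unit_cube n \<inter> Pi\<^sub>E {..<n} A = (\<Pi>\<^sub>E i\<in>{..<n}. {0<..<1} \<inter> A i)"
      by (auto simp: unit_cube_def PiE_iff)
    also have "emeasure (lborel_n n) \<dots> = (\<Prod>i<n. emeasure lborel ({0<..<1} \<inter> A i))"
      using A by (subst lborel_PiM.emeasure_PiM) auto
    also have "\<dots> = (\<Prod>i<n. emeasure (uniform_measure lborel {0<..<1}) (A i))"
      using A by (intro prod.cong) (auto simp: emeasure_uniform_measure divide_ennreal_def)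
    finally show "emeasure (density (lborel_n n) (indicator (unit_cube n))) (Pi\<^sub>E {..<n} A)
        = (\<Prod>i<n. emeasure (uniform_measure lborel {0<..<1}) (A i))" .
  qed simp
  then show ?thesis
    by (simp add: null_law_def)
qed

lemma prob_space_null_law: "prob_space (null_law n)"
  unfolding null_law_def
  by (intro prob_space_PiM prob_space_uniform_measure) simp_all

lemma measure_null_law:
  assumes "A \<in> sets (lborel_n n)" "A \<subseteq> unit_cube n"
  shows "measure (null_law n) A = measure (lborel_n n) A"
  using assms unfolding measure_def null_law_eq
  by (subst emeasure_restricted) (auto simp: Int_absorb1)

text \<open>The marginal of the product in coordinate \<open>i\<close> is the uniform law, which
  gives no mass to points.\<close>

lemma null_law_component_atomless:
  assumes "i < n"
  shows "measure (null_law n) {x \<in> space (null_law n). x i = a} = 0"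
proof -
  let ?U = "uniform_measure lborel {0<..<1::real}"
  have U: "prob_space ?U"
    by (rule prob_space_uniform_measure) simp_all
  have "emeasure (null_law n) {x \<in> space (null_law n). x i = a}
      = emeasure (distr (null_law n) ?U (\<lambda>x. x i)) {a}"
    using assms unfolding null_law_def
    by (subst emeasure_distr) (auto intro!: arg_cong2[where f = emeasure])
  also have "\<dots> = emeasure ?U {a}"
    using U assms unfolding null_law_def by (subst distr_PiM_component) auto
  also have "\<dots> = 0"
  proof -
    have "emeasure lborel ({0<..<1} \<inter> {a}) \<le> emeasure lborel {a}"
      by (rule emeasure_mono) auto
    then show ?thesis by (simp add: emeasure_uniform_measure)
  qed
  finally show ?thesis
    by (simp add: measure_def)
qed

lemma measurable_reflect [measurable]: "reflect n \<in> lborel_n n \<rightarrow>\<^sub>M lborel_n n"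
  unfolding reflect_def by measurable

text \<open>The preimage of a box is the box of the reflected sides, and reflecting a side preserves
  its length; agreement on boxes suffices.\<close>

lemma distr_reflect: "distr (lborel_n n) (lborel_n n) (reflect n) = lborel_n n"
proof (rule lborel_PiM.PiM_eqI)
  fix A :: "nat \<Rightarrow> real set"
  assume "\<And>i. i \<in> {..<n} \<Longrightarrow> A i \<in> sets lborel"
  then have A: "A i \<in> sets borel" if "i < n" for i
    using that by simp
  have A': "(\<lambda>x. 1 - x) -` A i \<in> sets borel" if "i < n" for i
    using measurable_sets_borel[OF _ A[OF that], of "\<lambda>x. 1 - x"] by simp
  have "reflect n -` Pi\<^sub>E {..<n} A \<inter> space (lborel_n n) = (\<Pi>\<^sub>E i\<in>{..<n}. (\<lambda>x. 1 - x) -` A i)"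
    by (auto simp: reflect_def space_PiM PiE_iff)
  then have "emeasure (distr (lborel_n n) (lborel_n n) (reflect n)) (Pi\<^sub>E {..<n} A)
      = emeasure (lborel_n n) (\<Pi>\<^sub>E i\<in>{..<n}. (\<lambda>x. 1 - x) -` A i)"
    using A by (subst emeasure_distr) (auto intro!: sets_PiM_I_finite)
  also have "\<dots> = (\<Prod>i<n. emeasure lborel ((\<lambda>x. 1 - x) -` A i))"
    using A' by (subst lborel_PiM.emeasure_PiM) auto
  also have "\<dots> = (\<Prod>i<n. emeasure (distr lborel borel (\<lambda>x. 1 - x)) (A i))"
    using A by (intro prod.cong) (auto simp: emeasure_distr)
  finally show "emeasure (distr (lborel_n n) (lborel_n n) (reflect n)) (Pi\<^sub>E {..<n} A)
      = (\<Prod>i<n. emeasure lborel (A i))"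
    by (simp only: lborel_distr_reflect)
qed simp_all

text \<open>The restriction to the space matters: \<open>reflect\<close> always returns an
  extensional function, so it can send a non-extensional \<open>x\<close>, which is not in the cube,
  into the cube.\<close>

lemma reflect_in_unit_cube_iff:
  "x \<in> space (lborel_n n) \<Longrightarrow> reflect n x \<in> unit_cube n \<longleftrightarrow> x \<in> unit_cube n"
  by (auto simp: reflect_def unit_cube_def space_PiM PiE_iff)

lemma p1_reflect: "p1 f n (reflect n x) = p2 f n x" and p2_reflect: "p2 f n (reflect n x) = p1 f n x"
  by (auto simp: p1_def p2_def reflect_def intro!: prod.cong)


section \<open>Integrability and power on symmetric regions\<close>

lemma integrable_density_on_unit_interval:
  assumes "density_on_unit_interval f"
  shows "set_integrable lborel {0<..<1} f"
proof -
  have f: "f \<in> borel_measurable (restrict_space borel {0<..<1})"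
    and nonneg: "\<And>x. x \<in> {0<..<1} \<Longrightarrow> 0 \<le> f x"
    and total: "(\<integral>\<^sup>+x\<in>{0<..<1}. ennreal (f x) \<partial>lborel) = 1"
    using assms by (auto simp: density_on_unit_interval_def)
  \<comment> \<open>Measurability of \<open>f\<close> is given only on the open interval; truncation
    by the indicator extends it to the line.\<close>
  have "(\<lambda>x. indicator {0<..<1} x *\<^sub>R f x) \<in> borel_measurable lborel"
    using f by (simp add: borel_measurable_restrict_space_iff)
  moreover have "0 \<le> indicator {0<..<1} x *\<^sub>R f x" for x
    using nonneg by (auto simp: indicator_def)
  moreover have "(\<integral>\<^sup>+x. ennreal (indicator {0<..<1} x *\<^sub>R f x) \<partial>lborel) < \<infinity>"
  proof -
    have "(\<integral>\<^sup>+x. ennreal (indicator {0<..<1} x *\<^sub>R f x) \<partial>lborel)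
        = (\<integral>\<^sup>+x\<in>{0<..<1}. ennreal (f x) \<partial>lborel)"
      by (intro nn_integral_cong) (auto simp: indicator_def)
    then show ?thesis
      using total by simp
  qed
  ultimately show ?thesis
    unfolding set_integrable_def by (intro integrableI_nonneg) auto
qed

lemma rejection_region_sets: "rejection_region n R \<Longrightarrow> R \<in> sets (lborel_n n)"
  by (simp add: rejection_region_def cong: sets_PiM_cong)

text \<open>Truncated to the cube, \<open>p1\<close> is the product of the truncated one-dimensional
  densities, and a product of integrable factors in separate coordinates is integrable.\<close>

lemma set_integrable_p1_unit_cube:
  assumes "density_on_unit_interval f"
  shows "set_integrable (lborel_n n) (unit_cube n) (p1 f n)"
proof -
  let ?g = "\<lambda>x. indicator {0<..<1} x *\<^sub>R f x"
  have "integrable lborel ?g"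
    using integrable_density_on_unit_interval[OF assms] by (simp add: set_integrable_def)
  then have "integrable (lborel_n n) (\<lambda>x. \<Prod>i<n. ?g (x i))"
    by (intro lborel_PiM.product_integrable_prod) auto
  also have "?this \<longleftrightarrow> integrable (lborel_n n) (\<lambda>x. indicator (unit_cube n) x *\<^sub>R p1 f n x)"
  proof (rule Bochner_Integration.integrable_cong)
    fix x :: "nat \<Rightarrow> real"
    assume "x \<in> space (lborel_n n)"
    then have "indicator (unit_cube n) x = (\<Prod>i<n. indicator {0<..<1} (x i) :: real)"
      by (auto simp: unit_cube_def space_PiM PiE_iff indicator_def)
    then show "(\<Prod>i<n. ?g (x i)) = indicator (unit_cube n) x *\<^sub>R p1 f n x"
      by (simp add: p1_def prod.distrib)
  qed simp
  finally show ?thesis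
    by (simp add: set_integrable_def)
qed

lemma set_integrable_p1:
  assumes "density_on_unit_interval f" "rejection_region n S"
  shows "set_integrable (lborel_n n) S (p1 f n)"
  using set_integrable_subset[OF set_integrable_p1_unit_cube] assms rejection_region_sets
  by (auto simp: rejection_region_def)

text \<open>Symmetry is stated for points of the cube only. Off the cube both indicators vanish,
  since the region lies in the cube and the reflection keeps outside points outside.\<close>

lemma indicator_reflect:
  assumes "rejection_region n S" "symmetric_region n S" "x \<in> space (lborel_n n)"
  shows "indicator S (reflect n x) = indicator S x"
  using assms reflect_in_unit_cube_iff[OF assms(3)]
  by (auto simp: rejection_region_def symmetric_region_def indicator_def)

lemma set_integrable_p2:
  assumes "density_on_unit_interval f" "rejection_region n S" "symmetric_region n S"
  shows "set_integrable (lborel_n n) S (p2 f n)"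
proof -
  have "integrable (distr (lborel_n n) (lborel_n n) (reflect n)) (\<lambda>x. indicator S x *\<^sub>R p1 f n x)"
    using set_integrable_p1[OF assms(1,2)] by (simp add: distr_reflect set_integrable_def)
  then have "integrable (lborel_n n) (\<lambda>x. indicator S (reflect n x) *\<^sub>R p1 f n (reflect n x))"
    by (rule integrable_distr[rotated]) simp
  also have "?this \<longleftrightarrow> ?thesis"
    unfolding set_integrable_def
    using assms by (intro Bochner_Integration.integrable_cong) (simp_all add: indicator_reflect p1_reflect)
  finally show ?thesis .
qed

text \<open>Substituting the measure-preserving reflection turns \<open>p1\<close> into
  \<open>p2\<close>, while the symmetry of \<open>S\<close> leaves the domain of integration
  unchanged.\<close>

lemma test_power_p2_eq_p1:
  assumes "density_on_unit_interval f" "rejection_region n S" "symmetric_region n S"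
  shows "test_power n (p2 f n) S = test_power n (p1 f n) S"
proof -
  have "(\<lambda>x. indicator S x *\<^sub>R p1 f n x) \<in> borel_measurable (lborel_n n)"
    using set_integrable_p1[OF assms(1,2)] by (auto simp: set_integrable_def)
  then have "(LINT x|distr (lborel_n n) (lborel_n n) (reflect n). indicator S x *\<^sub>R p1 f n x)
      = (LINT x|lborel_n n. indicator S (reflect n x) *\<^sub>R p1 f n (reflect n x))"
    by (intro integral_distr) simp_all
  also have "\<dots> = (LINT x|lborel_n n. indicator S x *\<^sub>R p2 f n x)"
    using assms by (intro Bochner_Integration.integral_cong) (simp_all add: indicator_reflect p1_reflect)
  finally show ?thesis
    by (simp add: test_power_def set_lebesgue_integral_def distr_reflect)
qed

definition mixture :: "(real \<Rightarrow> real) \<Rightarrow> nat \<Rightarrow> (nat \<Rightarrow> real) \<Rightarrow> real" where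
  "mixture f n x = 1/2 * (p1 f n x + p2 f n x)"

lemma mixture_reflect: "mixture f n (reflect n x) = mixture f n x"
  by (simp add: mixture_def p1_reflect p2_reflect)

text \<open>The power against the mixture is the average of two equal powers, so maximizing it over
  symmetric regions maximizes both at once.\<close>

lemma
  assumes "density_on_unit_interval f" "rejection_region n S" "symmetric_region n S"
  shows set_integrable_mixture: "set_integrable (lborel_n n) S (mixture f n)"
    and test_power_mixture: "test_power n (mixture f n) S = test_power n (p1 f n) S"
proof -
  note add = set_integral_add[OF set_integrable_p1[OF assms(1,2)] set_integrable_p2[OF assms]]
  show "set_integrable (lborel_n n) S (mixture f n)"
    unfolding mixture_def by (intro set_integrable_mult_right add(1))
  show "test_power n (mixture f n) S = test_power n (p1 f n) S"
    using add(2) test_power_p2_eq_p1[OF assms] by (simp add: test_power_def mixture_def)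
qed

section \<open>A symmetric region of exact level\<close>

lemma ex_level_region:
  assumes n: "n \<ge> 1" and f: "density_on_unit_interval f" and \<alpha>: "0 < \<alpha>" "\<alpha> \<le> 1"
  shows "\<exists>R\<in>level_symmetric_regions n \<alpha>. rejects_for_large_values n (mixture f n) R"
proof -
  have cube: "rejection_region n (unit_cube n)" "symmetric_region n (unit_cube n)"
    using sets_unit_cube[of n] reflect_in_unit_cube_iff[of _ n]
    by (auto simp: rejection_region_def symmetric_region_def space_PiM unit_cube_def PiE_iff
        cong: sets_PiM_cong)
  show ?thesis
  proof (cases "\<alpha> = 1")
    \<comment> \<open>The quantile argument needs \<alpha> < 1. Here the whole cube serves, with
      cutoff 0, because the mixture is nonnegative there.\<close>
    case True
    have "test_level n (unit_cube n) = \<alpha>"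
      using True measure_null_law[OF sets_unit_cube order_refl, of n]
      by (simp add: test_level_def measure_def emeasure_unit_cube)
    moreover have "0 \<le> mixture f n x" if "x \<in> unit_cube n" for x
      using f that
      by (auto simp: mixture_def p1_def p2_def density_on_unit_interval_def unit_cube_def PiE_iff
          intro!: add_nonneg_nonneg prod_nonneg)
    then have "rejects_for_large_values n (mixture f n) (unit_cube n)"
      unfolding rejects_for_large_values_def by (intro exI[of _ 0]) (auto simp: not_less)
    ultimately show ?thesis
      using cube by (auto simp: level_symmetric_regions_def)
  next
    case False
    \<comment> \<open>\<open>X\<close> is the mixture cut off outside the cube, where
      \<open>f\<close> is unconstrained, so that it is measurable on the whole space.
      \<open>Y\<close> splits ties; it is invariant under the reflection, and its coordinate 0
      exists because \<open>n \<ge> 1\<close>.\<close>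
    define X where "X x = indicator (unit_cube n) x *\<^sub>R mixture f n x" for x
    define Y where "Y x = \<bar>x 0 - 1/2 :: real\<bar>" for x :: "nat \<Rightarrow> real"
    interpret N: prob_space "null_law n"
      by (rule prob_space_null_law)
    have sets_N [measurable_cong]: "sets (null_law n) = sets (lborel_n n)"
      by (simp add: null_law_eq)
    have space_N: "space (null_law n) = space (lborel_n n)"
      using sets_N by (rule sets_eq_imp_space_eq)
    have X [measurable]: "X \<in> borel_measurable (lborel_n n)"
      using set_integrable_mixture[OF f cube] unfolding X_def set_integrable_def by auto
    have [measurable]: "(\<lambda>x. x 0) \<in> borel_measurable (lborel_n n)"
      using n measurable_component_singleton[of 0 "{..<n}" "\<lambda>_. lborel :: real measure"] by simp
    have Y [measurable]: "Y \<in> borel_measurable (lborel_n n)"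
      unfolding Y_def by measurable
    have atomless: "measure (null_law n) {x \<in> space (null_law n). Y x = y} = 0" for y
    proof -
      let ?E = "\<lambda>a. {x \<in> space (null_law n). x 0 = a}"
      \<comment> \<open>A level set of \<open>Y\<close> lies in two hyperplanes, each of them a null
        set.\<close>
      have "measure (null_law n) {x \<in> space (null_law n). Y x = y}
          \<le> measure (null_law n) (?E (1/2 + y) \<union> ?E (1/2 - y))"
        by (rule N.finite_measure_mono) (auto simp: Y_def)
      also have "\<dots> \<le> measure (null_law n) (?E (1/2 + y)) + measure (null_law n) (?E (1/2 - y))"
        by (rule measure_Un_le) auto
      also have "\<dots> = 0"
        using n by (simp add: null_law_component_atomless)
      finally show ?thesis
        by (simp add: measure_le_0_iff)
    qed
    obtain c B where B [measurable]: "B \<in> sets borel"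
      and level: "measure (null_law n) {x \<in> space (null_law n). X x > c \<or> X x = c \<and> Y x \<in> B} = \<alpha>"
      using N.ex_upper_region[of X Y \<alpha>] X Y atomless \<alpha> False by auto
    define A where "A = {x \<in> space (null_law n). X x > c \<or> X x = c \<and> Y x \<in> B}"
    \<comment> \<open>\<open>A\<close> may contain points outside the cube, where \<open>X\<close>
      is 0. Intersecting with the cube gives a rejection region and loses no probability, since the
      null law lives on the cube.\<close>
    define R where "R = A \<inter> unit_cube n"
    have A [measurable]: "A \<in> sets (lborel_n n)"
      unfolding A_def space_N by measurable
    have R_sets [measurable]: "R \<in> sets (lborel_n n)"
      unfolding R_def by measurable
    then have "rejection_region n R"
      by (simp add: rejection_region_def R_def cong: sets_PiM_cong)
    moreover have "symmetric_region n R"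
      unfolding symmetric_region_def
    proof
      fix x
      assume x: "x \<in> unit_cube n"
      then have space: "x \<in> space (lborel_n n)"
        using sets.sets_into_space[OF sets_unit_cube] by blast
      then have "reflect n x \<in> unit_cube n" "reflect n x \<in> space (lborel_n n)"
        using x reflect_in_unit_cube_iff measurable_space[OF measurable_reflect] by blast+
      moreover have "X (reflect n x) = X x"
        using x calculation by (simp add: X_def mixture_reflect)
      moreover have "Y (reflect n x) = Y x"
        using n by (auto simp: Y_def reflect_def)
      ultimately show "x \<in> R \<longleftrightarrow> reflect n x \<in> R"
        using x space by (simp add: R_def A_def space_N)
    qed
    moreover have "test_level n R = \<alpha>"
    proof -
      have "emeasure (null_law n) R = emeasure (null_law n) A"
        unfolding null_law_eq R_def by (simp add: emeasure_restricted Int_ac)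
      then show ?thesis
        using level by (simp add: test_level_def measure_def A_def)
    qed
    moreover have "rejects_for_large_values n (mixture f n) R"
      unfolding rejects_for_large_values_def
    proof (intro exI[of _ c] ballI)
      fix x
      assume x: "x \<in> unit_cube n"
      then have "x \<in> space (lborel_n n)"
        using sets.sets_into_space[OF sets_unit_cube] by blast
      then show "(c < mixture f n x \<longrightarrow> x \<in> R) \<and> (mixture f n x < c \<longrightarrow> x \<notin> R)"
        using x by (auto simp: R_def A_def X_def space_N)
    qed
    ultimately show ?thesis
      by (auto simp: level_symmetric_regions_def)
  qed
qed

section \<open>Optimality against both alternatives\<close>

theorem theorem2p1:
  fixes f :: "real \<Rightarrow> real" and n :: nat and \<alpha> :: real
  assumes "n \<ge> 1"
    and "density_on_unit_interval f"
    and "0 < \<alpha>" and "\<alpha> \<le> 1"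
  shows "\<exists>R \<in> level_symmetric_regions n \<alpha>.
           (\<forall>S \<in> level_symmetric_regions n \<alpha>.
              test_power n (p1 f n) S \<le> test_power n (p1 f n) R \<and>
              test_power n (p2 f n) S \<le> test_power n (p2 f n) R) \<and>
           rejects_for_large_values n (\<lambda>x. 1/2 * (p1 f n x + p2 f n x)) R"
proof -
  obtain R where R: "R \<in> level_symmetric_regions n \<alpha>"
    and large: "rejects_for_large_values n (mixture f n) R"
    using ex_level_region[OF assms] by blast
  obtain c where c: "\<And>x. x \<in> unit_cube n \<Longrightarrow> c < mixture f n x \<Longrightarrow> x \<in> R"
    "\<And>x. x \<in> unit_cube n \<Longrightarrow> mixture f n x < c \<Longrightarrow> x \<notin> R"
    using large by (auto simp: rejects_for_large_values_def)
  \<comment> \<open>Every competitor has Lebesgue volume exactly \<alpha>, which is the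
    equal-measure hypothesis of \<open>neyman_pearson\<close>; finiteness comes from the cube having
    volume 1.\<close>
  have region: "rejection_region n S" "symmetric_region n S" "S \<subseteq> unit_cube n" "S \<in> sets (lborel_n n)"
    "measure (lborel_n n) S = \<alpha>" "emeasure (lborel_n n) S < \<infinity>"
    if "S \<in> level_symmetric_regions n \<alpha>" for S
  proof -
    show S: "rejection_region n S" "symmetric_region n S"
      using that by (auto simp: level_symmetric_regions_def)
    then show sub: "S \<subseteq> unit_cube n" and sets: "S \<in> sets (lborel_n n)"
      by (auto simp: rejection_region_def dest: rejection_region_sets)
    show "measure (lborel_n n) S = \<alpha>"
      using that measure_null_law[OF sets sub] by (simp add: level_symmetric_regions_def test_level_def)
    show "emeasure (lborel_n n) S < \<infinity>"
      using emeasure_mono[OF sub sets_unit_cube] by (auto simp: emeasure_unit_cube intro: le_less_trans)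
  qed
  have "test_power n (mixture f n) S \<le> test_power n (mixture f n) R"
    if S: "S \<in> level_symmetric_regions n \<alpha>" for S
    unfolding test_power_def
  proof (rule neyman_pearson[where c = c])
    \<comment> \<open>Both sign conditions are contrapositives of the cutoff property, which speaks
      only of the cube; hence the appeal to the inclusions of \<open>R\<close> and \<open>S\<close>
      in it.\<close>
    show "c \<le> mixture f n x" if "x \<in> R - S" for x
      using that c(2) region(3)[OF R] by (meson DiffD1 not_less subsetD)
    show "mixture f n x \<le> c" if "x \<in> S - R" for x
      using that c(1) region(3)[OF S] by (meson DiffD1 DiffD2 not_less subsetD)
  qed (use region[OF R] region[OF S] assms(2) in \<open>auto intro: set_integrable_mixture\<close>)
  \<comment> \<open>On symmetric regions the mixture power equals the power against
    \<open>p1\<close> and against \<open>p2\<close>, so the single inequality yields both.\<close>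
  then have "test_power n (p1 f n) S \<le> test_power n (p1 f n) R \<and>
      test_power n (p2 f n) S \<le> test_power n (p2 f n) R"
    if "S \<in> level_symmetric_regions n \<alpha>" for S
    using that R region(1,2) assms(2) by (simp add: test_power_mixture test_power_p2_eq_p1)
  moreover have "mixture f n = (\<lambda>x. 1/2 * (p1 f n x + p2 f n x))"
    by (simp add: fun_eq_iff mixture_def)
  ultimately show ?thesis
    using R large by auto
qed

end
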